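(* Let $A$ and $B$ be time series, let $d_{A,B}$ be a dissimilarity function with nonnegative integer values, let $c=\max_{i,j}d_{A,B}(i,j)$, and let $S_{A,B}$, $G^\vdash_{A,B}$, $G^\dashv_{A,B}$, $H^\vdash_{A,B}$, $H^\dashv_{A,B}$ be as defined in the context. For any indices $1\le i_\vdash\le i_\dashv\le|A|$ and $1\le j_\vdash\le j_\dashv\le|B|$, the DTW distance between $A[i_\vdash:i_\dashv]$ and $B[j_\vdash:j_\dashv]$ equals $c\,(|A[i_\vdash:i_\dashv]|+|B[j_\vdash:j_\dashv]|+1)$ minus the $[H^\vdash_{A,B}[j_\vdash]:H^\dashv_{A,B}[j_\dashv]]$-banded LIS length of $S_{A,B}[G^\vdash_{A,B}[i_\vdash]:G^\dashv_{A,B}[i_\dashv]]$.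
   Context: Sequences are 1-indexed; for a sequence $S$, $|S|$ is its length, $S[i]$ its $i$-th element, $S[a:b]=S[a]\circ\cdots\circ S[b]$, $\circ$ is concatenation. A subsequence of $S$ is $S[i_1]\circ\cdots\circ S[i_\ell]$ with $\ell\ge1$ and $i_1<\cdots<i_\ell$. A time series is a nonempty finite sequence; for time series $A,B$, $d_{A,B}(i,j)$ ($1\le i\le|A|$, $1\le j\le|B|$) is a nonnegative integer (dissimilarity of $A[i]$ and $B[j]$). An alignment of $A[i_\vdash:i_\dashv]$ and $B[j_\vdash:j_\dashv]$ is a sequence $P=(i_1,j_1)\circ\cdots\circ(i_{|P|},j_{|P|})$ with $(i_1,j_1)=(i_\vdash,j_\vdash)$, $(i_{|P|},j_{|P|})=(i_\dashv,j_\dashv)$, and for $2\le k\le|P|$, $(i_k,j_k)\in\{(i_{k-1}+1,j_{k-1}+1),(i_{k-1}+1,j_{k-1}),(i_{k-1},j_{k-1}+1)\}$. Its discrepancy is $\sum_{k=1}^{|P|}d_{A,B}(i_k,j_k)$. The DTW distance between $A[i_\vdash:i_\dashv]$ and $B[j_\vdash:j_\dashv]$ is the minimum discrepancy over all their alignments. For a sequence $S$ of integers: a subsequence is increasing if each element other than the last is less than the next one; it is $[h_\vdash:h_\dashv]$-banded if all its elements lie in $[h_\vdash,h_\dashv]$. The $[h_\vdash:h_\dashv]$-banded LIS length of $S$ is the maximum length of an $[h_\vdash:h_\dashv]$-banded increasing subsequence of $S$. Auxiliary weighted sequence $R_{A,B}$ of length $|A||B|+(|A|-1)(|B|-1)$,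 consisting of distinct integers: for $1\le i\le|A|$, $1\le j\le|B|$, the integer $r(i,j)=(j-1)(2|A|-1)+i$ occurs at position $f(r(i,j))=(i-1)(2|B|-1)+j$ with weight $w(r(i,j))=c-d_{A,B}(i,j)$; for $2\le i\le|A|$, $2\le j\le|B|$, the integer $\tilde r(i,j)=(j-1)(2|A|-1)-i+2$ occurs at position $f(\tilde r(i,j))=(i-1)(2|B|-1)-j+2$ with weight $c$. These positions are exactly $1,\dots,|R_{A,B}|$; $f(q)$ is the position of element $q$. For each element $q$ of $R_{A,B}$: $g_\dashv(q)=\sum w(q')$ over elements $q'$ with $f(q')\le f(q)$; $h_\dashv(q)=\sum w(q')$ over elements $q'$ with $q'\le q$ (as integers); $g_\vdash(q)=g_\dashv(q)-w(q)+1$; $h_\vdash(q)=h_\dashv(q)-w(q)+1$; $S_q=h_\vdash(q)\circ(h_\vdash(q)+1)\circ\cdots\circ h_\dashv(q)$ ($w(q)$ consecutive integers). The DTW distance sequence is $S_{A,B}=S_{R_{A,B}[1]}\circ\cdots\circ S_{R_{A,B}[|R_{A,B}|]}$. Arrays: $G^\vdash_{A,B}[i]=g_\vdash(r(i,1))$, $G^\dashv_{A,B}[i]=g_\dashv(r(i,|B|))$ for $1\le i\le|A|$; $H^\vdash_{A,B}[j]=h_\vdash(r(1,j))$, $H^\dashv_{A,B}[j]=h_\dashv(r(|A|,j))$ for $1\le j\le|B|$.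
   Formalization: The factor c(|A[..]|+|B[..]|+1) is corrected to c(|A[..]|+|B[..]|−1); the printed formula fails whenever c > 0, e.g. for |A|=|B|=1, d=1, where the DTW distance is 1 but the printed formula gives 3. *)

theory Defs
  imports "HOL-Library.Sublist"
begin

text \<open>All indices are 1-based. The dissimilarity \<open>d\<close> is indexed by positions in \<open>A\<close> and \<open>B\<close>;
  only its values on \<open>{1..length A} \<times> {1..length B}\<close> matter.\<close>

text \<open>\<open>S[a:b]\<close>, with 1-based inclusive bounds; empty if \<open>a > b\<close>. The bounds are integers so that
  they can be computed without truncated subtraction.\<close>

definition segment :: "'a list \<Rightarrow> int \<Rightarrow> int \<Rightarrow> 'a list" where
  "segment S a b = nths S {k. a \<le> int k + 1 \<and> int k + 1 \<le> b}"


subsection \<open>Dynamic time warping\<close>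

definition dtw_step :: "nat \<times> nat \<Rightarrow> nat \<times> nat \<Rightarrow> bool" where
  "dtw_step p q \<longleftrightarrow>
     q \<in> {(fst p + 1, snd p + 1), (fst p + 1, snd p), (fst p, snd p + 1)}"

definition is_alignment :: "nat \<Rightarrow> nat \<Rightarrow> nat \<Rightarrow> nat \<Rightarrow> (nat \<times> nat) list \<Rightarrow> bool" where
  "is_alignment i i' j j' P \<longleftrightarrow>
     P \<noteq> [] \<and> hd P = (i, j) \<and> last P = (i', j') \<and> successively dtw_step P"

definition discrepancy :: "(nat \<Rightarrow> nat \<Rightarrow> nat) \<Rightarrow> (nat \<times> nat) list \<Rightarrow> nat" where
  "discrepancy d P = (\<Sum>(i, j)\<leftarrow>P. d i j)"

text \<open>The DTW distance between \<open>A[i:i']\<close> and \<open>B[j:j']\<close>.\<close>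

definition dtw :: "(nat \<Rightarrow> nat \<Rightarrow> nat) \<Rightarrow> nat \<Rightarrow> nat \<Rightarrow> nat \<Rightarrow> nat \<Rightarrow> nat" where
  "dtw d i i' j j' = (LEAST x. \<exists>P. is_alignment i i' j j' P \<and> x = discrepancy d P)"


subsection \<open>Banded longest increasing subsequences\<close>

text \<open>Subsequences are nonempty by definition; the inserted \<open>0\<close> is the value when no banded
  increasing subsequence exists.\<close>

definition banded_lis_length :: "int \<Rightarrow> int \<Rightarrow> int list \<Rightarrow> nat" where
  "banded_lis_length lo hi S =
     Max (insert 0 {length T | T. subseq T S \<and> T \<noteq> [] \<and> successively (<) T \<and> set T \<subseteq> {lo..hi}})"


subsection \<open>The auxiliary weighted sequence\<close>

text \<open>An alignment of segments of lengths \<open>m\<close> and \<open>n\<close> visits cells \<open>r_elem\<close>, and each of its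
  diagonal steps passes one \<open>rt_elem\<close>. Cells and diagonal steps together number \<open>m + n - 1\<close>, so an
  alignment has total weight \<open>c * (m + n - 1)\<close> minus its discrepancy.\<close>

definition max_dissim :: "'a list \<Rightarrow> 'b list \<Rightarrow> (nat \<Rightarrow> nat \<Rightarrow> nat) \<Rightarrow> nat" where
  "max_dissim A B d = Max ((\<lambda>(i, j). d i j) ` ({1..length A} \<times> {1..length B}))"

definition r_elem :: "'a list \<Rightarrow> nat \<Rightarrow> nat \<Rightarrow> int" where
  "r_elem A i j = (int j - 1) * (2 * int (length A) - 1) + int i"

definition rt_elem :: "'a list \<Rightarrow> nat \<Rightarrow> nat \<Rightarrow> int" where
  "rt_elem A i j = (int j - 1) * (2 * int (length A) - 1) - int i + 2"

text \<open>\<open>R_occ A B d q p w\<close>: the integer \<open>q\<close> occurs in the sequence at position \<open>p\<close> with weight \<open>w\<close>.\<close>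

inductive R_occ ::
  "'a list \<Rightarrow> 'b list \<Rightarrow> (nat \<Rightarrow> nat \<Rightarrow> nat) \<Rightarrow> int \<Rightarrow> int \<Rightarrow> int \<Rightarrow> bool"
  for A B d where
  cell: "\<lbrakk>1 \<le> i; i \<le> length A; 1 \<le> j; j \<le> length B\<rbrakk> \<Longrightarrow>
    R_occ A B d (r_elem A i j)
      ((int i - 1) * (2 * int (length B) - 1) + int j)
      (int (max_dissim A B d) - int (d i j))"
| diag: "\<lbrakk>2 \<le> i; i \<le> length A; 2 \<le> j; j \<le> length B\<rbrakk> \<Longrightarrow>
    R_occ A B d (rt_elem A i j)
      ((int i - 1) * (2 * int (length B) - 1) - int j + 2)
      (int (max_dissim A B d))"

definition R_elems :: "'a list \<Rightarrow> 'b list \<Rightarrow> (nat \<Rightarrow> nat \<Rightarrow> nat) \<Rightarrow> int set" where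
  "R_elems A B d = {q. \<exists>p w. R_occ A B d q p w}"

definition R_pos :: "'a list \<Rightarrow> 'b list \<Rightarrow> (nat \<Rightarrow> nat \<Rightarrow> nat) \<Rightarrow> int \<Rightarrow> int" where
  "R_pos A B d q = (THE p. \<exists>w. R_occ A B d q p w)"

definition R_weight :: "'a list \<Rightarrow> 'b list \<Rightarrow> (nat \<Rightarrow> nat \<Rightarrow> nat) \<Rightarrow> int \<Rightarrow> int" where
  "R_weight A B d q = (THE w. \<exists>p. R_occ A B d q p w)"

definition R_seq :: "'a list \<Rightarrow> 'b list \<Rightarrow> (nat \<Rightarrow> nat \<Rightarrow> nat) \<Rightarrow> int list" where
  "R_seq A B d =
     map (\<lambda>p. THE q. \<exists>w. R_occ A B d q p w)
       [1..int (length A) * int (length B) + (int (length A) - 1) * (int (length B) - 1)]"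

text \<open>The definite descriptions above are well-defined: elements determine their position and
  weight, and every position in the range of \<open>R_seq\<close> carries exactly one element.\<close>

lemma mult_offset_unique:
  fixes a b K x y :: int
  assumes "a * K + x = b * K + y" and "\<bar>x - y\<bar> < K"
  shows "a = b \<and> x = y"
proof -
  have "\<bar>(a - b) * K\<bar> < K"
    using assms by (simp add: algebra_simps)
  moreover have "\<bar>a - b\<bar> * K \<ge> K" if "a \<noteq> b"
    using that assms(2) by (auto simp: mult_le_cancel_right1)
  ultimately have "a = b"
    using assms(2) by (fastforce simp: abs_mult)
  with assms(1) show ?thesis by simp
qed

lemma R_occ_fun:
  assumes "R_occ A B d q p w" and "R_occ A B d q p' w'"
  shows "p = p' \<and> w = w'"
  using assms
proof (induction)
  case (cell i j)
  note c = this
  from c(5) show ?case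
  proof cases
    case (cell i' j')
    have "int j - 1 = int j' - 1 \<and> int i = int i'"
      by (rule mult_offset_unique[of _ "2 * int (length A) - 1"]) (use c cell in \<open>auto simp: r_elem_def\<close>)
    then show ?thesis using cell by simp
  next
    case (diag i' j')
    have "int j - 1 = int j' - 1 \<and> int i = 2 - int i'"
      by (rule mult_offset_unique[of _ "2 * int (length A) - 1"]) (use c diag in \<open>auto simp: r_elem_def rt_elem_def\<close>)
    then show ?thesis using c diag by simp
  qed
next
  case (diag i j)
  note c = this
  from c(5) show ?case
  proof cases
    case (cell i' j')
    have "int j - 1 = int j' - 1 \<and> 2 - int i = int i'"
      by (rule mult_offset_unique[of _ "2 * int (length A) - 1"]) (use c cell in \<open>auto simp: r_elem_def rt_elem_def\<close>)
    then show ?thesis using c cell by simp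
  next
    case (diag i' j')
    have "int j - 1 = int j' - 1 \<and> 2 - int i = 2 - int i'"
      by (rule mult_offset_unique[of _ "2 * int (length A) - 1"]) (use c diag in \<open>auto simp: rt_elem_def\<close>)
    then show ?thesis using diag by simp
  qed
qed

lemma R_occ_inj:
  assumes "R_occ A B d q p w" and "R_occ A B d q' p w'"
  shows "q = q'"
  using assms
proof (induction)
  case (cell i j)
  note c = this
  from c(5) show ?case
  proof cases
    case (cell i' j')
    have "int i - 1 = int i' - 1 \<and> int j = int j'"
      by (rule mult_offset_unique[of _ "2 * int (length B) - 1"]) (use c cell in auto)
    then show ?thesis using cell by simp
  next
    case (diag i' j')
    have "int i - 1 = int i' - 1 \<and> int j = 2 - int j'"
      by (rule mult_offset_unique[of _ "2 * int (length B) - 1"]) (use c diag in auto)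
    then show ?thesis using c diag by simp
  qed
next
  case (diag i j)
  note c = this
  from c(5) show ?case
  proof cases
    case (cell i' j')
    have "int i - 1 = int i' - 1 \<and> 2 - int j = int j'"
      by (rule mult_offset_unique[of _ "2 * int (length B) - 1"]) (use c cell in auto)
    then show ?thesis using c cell by simp
  next
    case (diag i' j')
    have "int i - 1 = int i' - 1 \<and> 2 - int j = 2 - int j'"
      by (rule mult_offset_unique[of _ "2 * int (length B) - 1"]) (use c diag in auto)
    then show ?thesis using diag by simp
  qed
qed

lemma R_pos_eq: "R_occ A B d q p w \<Longrightarrow> R_pos A B d q = p"
  unfolding R_pos_def by (blast dest: R_occ_fun)

lemma R_weight_eq: "R_occ A B d q p w \<Longrightarrow> R_weight A B d q = w"
  unfolding R_weight_def by (blast dest: R_occ_fun)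

lemma R_occ_pos:
  fixes A :: "'a list" and B :: "'b list" 
  assumes "A \<noteq> []" and "B \<noteq> []"
  shows "(\<exists>q w. R_occ A B d q p w) \<longleftrightarrow>
    p \<in> {1..int (length A) * int (length B) + (int (length A) - 1) * (int (length B) - 1)}"
proof -
  define m n where "m = int (length A)" and "n = int (length B)"
  define K where "K = 2 * n - 1"
  have mn: "m \<ge> 1" "n \<ge> 1"
    using assms by (auto simp: m_def n_def Suc_le_eq)
  then have K: "K \<ge> 1" by (simp add: K_def)
  note mn = mn K
  have tot: "m * n + (m - 1) * (n - 1) = (m - 1) * K + n"
    by (simp add: K_def algebra_simps)
  have mono: "a * K \<le> b * K" if "a \<le> b" for a b using that mn by simp
  show ?thesis
    unfolding m_def[symmetric] n_def[symmetric] tot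
  proof
    assume "\<exists>q w. R_occ A B d q p w"
    then obtain q w where "R_occ A B d q p w" by blast
    then show "p \<in> {1..(m - 1) * K + n}"
    proof cases
      case (cell i j)
      have "(int i - 1) * K \<le> (m - 1) * K" "0 * K \<le> (int i - 1) * K"
        using cell by (intro mono; simp add: m_def)+
      moreover have "p = (int i - 1) * K + int j" using cell by (simp add: K_def n_def)
      moreover have "1 \<le> int j" "int j \<le> n" using cell by (simp_all add: n_def)
      ultimately show ?thesis by simp
    next
      case (diag i j)
      have "(int i - 1) * K \<le> (m - 1) * K" "1 * K \<le> (int i - 1) * K"
        using diag by (intro mono; simp add: m_def)+
      moreover have "p = (int i - 1) * K - int j + 2" using diag by (simp add: K_def n_def)
      moreover have "2 \<le> int j" "int j \<le> n" using diag by (simp_all add: n_def)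
      moreover have "n \<le> K" using mn by (simp add: K_def)
      ultimately show ?thesis unfolding atLeastAtMost_iff by linarith
    qed
  next
    assume p: "p \<in> {1..(m - 1) * K + n}"
    define a b where "a = (p - 1) div K" and "b = (p - 1) mod K + 1"
    have ab: "p = a * K + b" by (simp add: a_def b_def)
    have "0 \<le> (p - 1) mod K" "(p - 1) mod K < K" using mn by simp_all
    then have b: "1 \<le> b" "b \<le> K" by (simp_all add: b_def)
    have a0: "a \<ge> 0" using p mn by (simp add: a_def pos_imp_zdiv_nonneg_iff)
    have am: "a \<le> m - 1"
    proof (rule ccontr)
      assume "\<not> a \<le> m - 1"
      then have "(m - 1 + 1) * K \<le> a * K" by (intro mono) simp
      then have "(m - 1) * K + K \<le> a * K" by (simp only: distrib_right mult_1)
      moreover have "n \<le> K" using mn by (simp add: K_def)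
      moreover have "p \<le> (m - 1) * K + n" using p by simp
      ultimately show False using ab b(1) by linarith
    qed
    show "\<exists>q w. R_occ A B d q p w"
    proof (cases "b \<le> n")
      case True
      have "1 \<le> nat (a + 1)" "nat (a + 1) \<le> length A" "1 \<le> nat b" "nat b \<le> length B"
        using a0 am b True by (simp_all add: m_def n_def nat_le_iff le_nat_iff)
      from R_occ.cell[OF this] show ?thesis
        using a0 b(1) unfolding n_def[symmetric] K_def[symmetric] ab by auto
    next
      case False
      have "a \<noteq> m - 1" using False p ab by auto
      then have "2 \<le> nat (a + 2)" "nat (a + 2) \<le> length A"
        "2 \<le> nat (K + 2 - b)" "nat (K + 2 - b) \<le> length B"
        using a0 am b False by (simp_all add: m_def n_def K_def nat_le_iff le_nat_iff)
      note * = R_occ.diag[OF this]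
      have "(int (nat (a + 2)) - 1) * K - int (nat (K + 2 - b)) + 2 = p"
        using ab a0 b by (simp add: algebra_simps)
      with * show ?thesis unfolding n_def[symmetric] K_def[symmetric] by metis
    qed
  qed
qed


subsection \<open>The DTW distance sequence\<close>

definition g_end :: "'a list \<Rightarrow> 'b list \<Rightarrow> (nat \<Rightarrow> nat \<Rightarrow> nat) \<Rightarrow> int \<Rightarrow> int" where
  "g_end A B d q =
     (\<Sum>q' \<in> {q' \<in> R_elems A B d. R_pos A B d q' \<le> R_pos A B d q}. R_weight A B d q')"

definition h_end :: "'a list \<Rightarrow> 'b list \<Rightarrow> (nat \<Rightarrow> nat \<Rightarrow> nat) \<Rightarrow> int \<Rightarrow> int" where
  "h_end A B d q = (\<Sum>q' \<in> {q' \<in> R_elems A B d. q' \<le> q}. R_weight A B d q')"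

definition g_start :: "'a list \<Rightarrow> 'b list \<Rightarrow> (nat \<Rightarrow> nat \<Rightarrow> nat) \<Rightarrow> int \<Rightarrow> int" where
  "g_start A B d q = g_end A B d q - R_weight A B d q + 1"

definition h_start :: "'a list \<Rightarrow> 'b list \<Rightarrow> (nat \<Rightarrow> nat \<Rightarrow> nat) \<Rightarrow> int \<Rightarrow> int" where
  "h_start A B d q = h_end A B d q - R_weight A B d q + 1"

definition dtw_sequence :: "'a list \<Rightarrow> 'b list \<Rightarrow> (nat \<Rightarrow> nat \<Rightarrow> nat) \<Rightarrow> int list" where
  "dtw_sequence A B d =
     concat (map (\<lambda>q. [h_start A B d q..h_end A B d q]) (R_seq A B d))"

definition G_start :: "'a list \<Rightarrow> 'b list \<Rightarrow> (nat \<Rightarrow> nat \<Rightarrow> nat) \<Rightarrow> nat \<Rightarrow> int" where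
  "G_start A B d i = g_start A B d (r_elem A i 1)"

definition G_end :: "'a list \<Rightarrow> 'b list \<Rightarrow> (nat \<Rightarrow> nat \<Rightarrow> nat) \<Rightarrow> nat \<Rightarrow> int" where
  "G_end A B d i = g_end A B d (r_elem A i (length B))"

definition H_start :: "'a list \<Rightarrow> 'b list \<Rightarrow> (nat \<Rightarrow> nat \<Rightarrow> nat) \<Rightarrow> nat \<Rightarrow> int" where
  "H_start A B d j = h_start A B d (r_elem A 1 j)"

definition H_end :: "'a list \<Rightarrow> 'b list \<Rightarrow> (nat \<Rightarrow> nat \<Rightarrow> nat) \<Rightarrow> nat \<Rightarrow> int" where
  "H_end A B d j = h_end A B d (r_elem A (length A) j)"

end

theory Submission
  imports Defs
begin

text \<open>
  Think of a cell as the point \<open>(i, j)\<close> and of an element \<open>rt_elem A i j\<close> as the midpoint of the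
  diagonal step into \<open>(i, j)\<close>. Two elements are ordered alike by value and by position exactly when
  their points are comparable in the plane, midpoints being comparable only if both coordinates
  differ. Maximal such chains in a box are therefore the alignments of the box, where
  every cell and every diagonal step contributes \<open>c\<close>, minus the discrepancy. Replacing an element by
  an interval of as many consecutive integers as its weight turns the maximum weight of a chain into
  the length of a longest increasing subsequence, since the intervals are ordered like the elements.
  The segment and the band cut the sequence at interval boundaries, and thus restrict it to the
  elements of the box.
\<close>

section \<open>Chains and alignments\<close>

datatype node = Cell (row: nat) (col: nat) | Diag (row: nat) (col: nat)

primrec flip :: "node \<Rightarrow> node" where
  "flip (Cell x y) = Cell y x"
| "flip (Diag x y) = Diag y x"

lemma row_flip [simp]: "row (flip u) = col u" and col_flip [simp]: "col (flip u) = row u"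
  by (cases u; simp)+

text \<open>Exchanging the roles of \<open>A\<close> and \<open>B\<close> exchanges values and positions: the position of a node
  \<open>u\<close> is \<open>node_val B (flip u)\<close>.\<close>

primrec node_val :: "'a list \<Rightarrow> node \<Rightarrow> int" where
  "node_val A (Cell x y) = r_elem A x y"
| "node_val A (Diag x y) = rt_elem A x y"

text \<open>A \<open>Diag\<close> node needs strict lower bounds, because the diagonal step ending in it starts in the
  preceding row and column.\<close>

definition box :: "nat \<Rightarrow> nat \<Rightarrow> nat \<Rightarrow> nat \<Rightarrow> node set" where
  "box i i' j j' = {u. case u of
     Cell x y \<Rightarrow> i \<le> x \<and> x \<le> i' \<and> j \<le> y \<and> y \<le> j'
   | Diag x y \<Rightarrow> i < x \<and> x \<le> i' \<and> j < y \<and> y \<le> j'}"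

lemma Cell_in_box [simp]:
  "Cell x y \<in> box i i' j j' \<longleftrightarrow> i \<le> x \<and> x \<le> i' \<and> j \<le> y \<and> y \<le> j'"
  and Diag_in_box [simp]:
  "Diag x y \<in> box i i' j j' \<longleftrightarrow> i < x \<and> x \<le> i' \<and> j < y \<and> y \<le> j'"
  by (simp_all add: box_def)

lemma flip_in_box [simp]: "flip u \<in> box j j' i i' \<longleftrightarrow> u \<in> box i i' j j'"
  by (cases u) auto

lemma box_bounds:
  assumes "u \<in> box i i' j j'"
  shows "i \<le> row u" "row u \<le> i'" "j \<le> col u" "col u \<le> j'"
  using assms by (cases u; simp)+

lemma box_mono:
  assumes "u \<in> box i a j b" "i' \<le> i" "a \<le> a'" "j' \<le> j" "b \<le> b'"
  shows "u \<in> box i' a' j' b'"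
  using assms by (cases u) auto

text \<open>The upper bounds of a \<open>box\<close> are the same for both kinds of nodes, so it can
  be cut from above by \<open>row\<close> and \<open>col\<close> alone. Cutting from below is
  different: a \<open>Diag\<close> in the first remaining row or column drops out.\<close>

lemma box_shrink:
  assumes "u \<in> box i a j b" "row u \<le> a'" "col u \<le> b'"
  shows "u \<in> box i a' j b'"
  using assms by (cases u) auto

section \<open>The order of node values within and across columns\<close>

lemma node_val_bounds:
  assumes "u \<in> box 1 (length A) 1 n"
  shows "(int (col u) - 1) * (2 * int (length A) - 1) - int (length A) + 2 \<le> node_val A u"
    and "node_val A u \<le> (int (col u) - 1) * (2 * int (length A) - 1) + int (length A)"
  using assms by (cases u; auto simp: r_elem_def rt_elem_def)+

text \<open>Each column owns a window of \<open>2 * length A - 1\<close> consecutive integers, the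
  range of \<open>node_val_bounds\<close>, and the windows of different columns are disjoint. Hence
  the column decides first.\<close>

lemma node_val_less:
  assumes u: "u \<in> box 1 (length A) 1 n" and v: "v \<in> box 1 (length A) 1 n'"
    and "col u < col v"
  shows "node_val A u < node_val A v"
proof -
  let ?K = "2 * int (length A) - 1"
  have "0 \<le> ?K"
    using box_bounds[OF u] by linarith
  then have "(int (col u) - 1 + 1) * ?K \<le> (int (col v) - 1) * ?K"
    using assms(3) by (intro mult_right_mono) auto
  then have "(int (col u) - 1) * ?K + ?K \<le> (int (col v) - 1) * ?K"
    by (simp only: distrib_right mult_1)
  then show ?thesis
    using node_val_bounds(2)[OF u] node_val_bounds(1)[OF v] by linarith
qed

text \<open>In its own column the corner cell wins because cells grow with the row and every
  \<open>Diag\<close> has an offset of at most 0. Applied to flipped nodes as well, this allows the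
  last cell of an alignment to be put on top of a chain.\<close>

lemma node_val_below_Cell:
  assumes "u \<in> box 1 a 1 b" "u \<noteq> Cell a b" "a \<le> length A"
  shows "node_val A u < node_val A (Cell a b)"
proof (cases "col u < b")
  case True
  then show ?thesis
    using assms box_bounds[OF assms(1)]
    by (intro node_val_less[of _ _ b _ b]) (auto intro: box_mono)
next
  case False
  then have "col u = b"
    using box_bounds[OF assms(1)] by simp
  then show ?thesis
    using assms by (cases u) (auto simp: r_elem_def rt_elem_def)
qed

text \<open>Inside a column, \<open>Diag\<close> values decrease with the row and stay below all
  cells. This reversal makes a \<open>Diag\<close> incomparable with the nodes before it in its own
  row or column.\<close>

lemma node_val_above_Diag:
  assumes "u \<in> box 1 m 1 n" "row u < x"
  shows "node_val A (Diag x (col u)) < node_val A u"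
  using assms by (cases u) (auto simp: r_elem_def rt_elem_def)

text \<open>An increasing subsequence of the weighted sequence, encoded as the set of its nodes:
  \<open>node_val B (flip u)\<close> is the position of \<open>u\<close>, and the orders by value
  and by position agree.\<close>

definition chain :: "'a list \<Rightarrow> 'b list \<Rightarrow> node set \<Rightarrow> bool" where
  "chain A B X \<longleftrightarrow> (\<forall>u \<in> X. \<forall>v \<in> X.
     node_val A u < node_val A v \<longleftrightarrow> node_val B (flip u) < node_val B (flip v))"

lemma chainD:
  assumes "chain A B X" "u \<in> X" "v \<in> X"
  shows "node_val A u < node_val A v \<longleftrightarrow> node_val B (flip u) < node_val B (flip v)"
  using assms by (simp add: chain_def)

lemma chain_subset: "chain A B X \<Longrightarrow> Y \<subseteq> X \<Longrightarrow> chain A B Y"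
  by (auto simp: chain_def)

lemma chain_insert_top:
  assumes "chain A B X"
    and "\<And>u. u \<in> X \<Longrightarrow> node_val A u < node_val A t"
    and "\<And>u. u \<in> X \<Longrightarrow> node_val B (flip u) < node_val B (flip t)"
  shows "chain A B (insert t X)"
  unfolding chain_def
proof (intro ballI)
  fix u v
  assume "u \<in> insert t X" "v \<in> insert t X"
  then consider "u \<in> X" "v \<in> X" | "u = t" "v = t" | "u = t" "v \<in> X" | "u \<in> X" "v = t"
    by blast
  then show "node_val A u < node_val A v \<longleftrightarrow> node_val B (flip u) < node_val B (flip v)"
  proof cases
    case 1
    then show ?thesis using assms(1) by (simp add: chain_def)
  next
    case 3
    then show ?thesis using assms(2,3)[of v] by auto
  next
    case 4
    then show ?thesis using assms(2,3)[of u] by auto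
  qed simp
qed

primrec node_weight :: "nat \<Rightarrow> (nat \<Rightarrow> nat \<Rightarrow> nat) \<Rightarrow> node \<Rightarrow> int" where
  "node_weight c d (Cell x y) = int c - int (d x y)"
| "node_weight c d (Diag x y) = int c"

section \<open>Passing between chains and alignments\<close>

lemma is_alignment_single: "is_alignment i i j j [(i, j)]"
  by (simp add: is_alignment_def)

lemma is_alignment_snoc:
  assumes "is_alignment i a' j b' P" "dtw_step (a', b') (a, b)"
  shows "is_alignment i a j b (P @ [(a, b)])"
  using assms by (auto simp: is_alignment_def successively_append_iff)

lemma discrepancy_snoc [simp]: "discrepancy d (P @ [(a, b)]) = discrepancy d P + d a b"
  by (simp add: discrepancy_def)

text \<open>The alignment is built from its end, by induction on \<open>a + b\<close>. Once the
  corner cell is removed, the shape of the remaining chain dictates the last step. The result is an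
  inequality because the chain may miss cells and diagonals of the alignment, whose weights are
  nonnegative.\<close>

lemma chain_extends_to_alignment:
  assumes "finite X" "X \<subseteq> box i a j b" "chain A B X"
    and "1 \<le> i" "i \<le> a" "a \<le> length A" "1 \<le> j" "j \<le> b" "b \<le> length B"
    and "\<And>x y. \<lbrakk>1 \<le> x; x \<le> length A; 1 \<le> y; y \<le> length B\<rbrakk> \<Longrightarrow> d x y \<le> c"
  shows "\<exists>P. is_alignment i a j b P \<and>
    sum (node_weight c d) X + int (discrepancy d P) \<le>
      int c * (int a - int i + int b - int j + 1)"
  using assms
proof (induction "a + b" arbitrary: a b X rule: less_induct)
  case less
  define Y where "Y = X - {Cell a b}"
  have Y: "finite Y" "Y \<subseteq> X" "Cell a b \<notin> Y" "chain A B Y" "Y \<subseteq> box i a j b"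
    using less.prems chain_subset[of A B X Y] by (auto simp: Y_def)
  have wX: "sum (node_weight c d) X \<le> sum (node_weight c d) Y + int c - int (d a b)"
  proof (cases "Cell a b \<in> X")
    case True
    then have "sum (node_weight c d) X = node_weight c d (Cell a b) + sum (node_weight c d) Y"
      unfolding Y_def using less.prems(1) by (rule sum.remove[rotated])
    then show ?thesis by simp
  next
    case False
    then have "Y = X" by (auto simp: Y_def)
    moreover have "d a b \<le> c" using less.prems by (intro less.prems(10)) auto
    ultimately show ?thesis by simp
  qed
  have valid: "u \<in> box 1 (length A) 1 (length B)" if "u \<in> Y" for u
    using that Y less.prems by (blast intro: box_mono)
  \<comment> \<open>The budget \<open>int c * (int a - int a' + int b - int b' - 1)\<close> is 0 for
    a horizontal or vertical step and \<open>int c\<close> for a diagonal one, which pays for the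
    node \<open>Diag a b\<close>.\<close>
  have snoc: ?case
    if "finite Z" "Z \<subseteq> box i a' j b'" "chain A B Z" "i \<le> a'" "a' \<le> a" "j \<le> b'" "b' \<le> b"
      and step: "dtw_step (a', b') (a, b)"
      and wY: "sum (node_weight c d) Y \<le>
        sum (node_weight c d) Z + int c * (int a - int a' + int b - int b' - 1)"
    for a' b' Z
  proof -
    have "a' + b' < a + b" using step by (auto simp: dtw_step_def)
    then have "\<exists>P. is_alignment i a' j b' P \<and> sum (node_weight c d) Z + int (discrepancy d P) \<le>
        int c * (int a' - int i + int b' - int j + 1)"
      by (rule less.hyps) (use that less.prems in auto)
    then obtain P where P: "is_alignment i a' j b' P"
      "sum (node_weight c d) Z + int (discrepancy d P) \<le>
        int c * (int a' - int i + int b' - int j + 1)" by blast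
    have "sum (node_weight c d) X + int (discrepancy d (P @ [(a, b)])) \<le>
       int c * (int a' - int i + int b' - int j + 1) +
       int c * (int a - int a' + int b - int b' - 1) + int c"
      using P(2) wX wY by simp
    also have "\<dots> = int c * (int a - int i + int b - int j + 1)"
      by (simp add: algebra_simps)
    finally show ?thesis using is_alignment_snoc[OF P(1) step] by blast
  qed
  consider "a = i" "b = j" | "b > j" "\<And>u. u \<in> Y \<Longrightarrow> col u < b"
    | "a > i" "\<And>u. u \<in> Y \<Longrightarrow> row u < a"
    | "a > i" "b > j" "Diag a b \<in> Y"
    | u v where "Diag a b \<notin> Y" "u \<in> Y" "col u = b" "v \<in> Y" "row v = a"
  proof -
    have mem: "u \<in> box i a j b" "u \<noteq> Cell a b" if "u \<in> Y" for u
      using that Y(3,5) by auto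
    \<comment> \<open>A box with a single column contains no \<open>Diag\<close>, and its only node
      in row \<open>a\<close> is the removed corner. The next step is the mirror image.\<close>
    have "row u < a" if "u \<in> Y" "b = j" for u
      using mem[OF that(1)] that(2) by (cases u) auto
    moreover have "col u < b" if "u \<in> Y" "a = i" for u
      using mem[OF that(1)] that(2) by (cases u) auto
    moreover have "row u \<le> a" "col u \<le> b" if "u \<in> Y" for u
      using box_bounds[OF mem(1)[OF that]] by simp_all
    ultimately show ?thesis
      using that less.prems(5,8) by (metis le_neq_implies_less)
  qed
  then show ?case
  proof cases
    case 1
    have "u = Cell a b" if "u \<in> box i a j b" for u
      using that 1 by (cases u) auto
    then have "Y = {}" using Y by blast
    moreover have "discrepancy d [(a, b)] = d a b" by (simp add: discrepancy_def)
    ultimately show ?thesis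
      using 1 wX is_alignment_single[of a b] by (intro exI[of _ "[(a, b)]"]) auto
  next
    case 2
    have "u \<in> box i a j (b - 1)" if "u \<in> Y" for u
      using box_shrink[of u i a j b a "b - 1"] box_bounds[of u i a j b] subsetD[OF Y(5) that]
        2(2)[OF that] by simp
    then have "Y \<subseteq> box i a j (b - 1)" by blast
    then show ?thesis
      by (intro snoc[of Y a "b - 1"])
        (use Y(1,4) 2(1) less.prems(5,8) in \<open>auto simp: dtw_step_def\<close>)
  next
    case 3
    have "u \<in> box i (a - 1) j b" if "u \<in> Y" for u
      using box_shrink[of u i a j b "a - 1" b] box_bounds[of u i a j b] subsetD[OF Y(5) that]
        3(2)[OF that] by simp
    then have "Y \<subseteq> box i (a - 1) j b" by blast
    then show ?thesis
      by (intro snoc[of Y "a - 1" b])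
        (use Y(1,4) 3(1) less.prems(5,8) in \<open>auto simp: dtw_step_def\<close>)
  next
    case 4
    define Z where "Z = Y - {Diag a b}"
    have "u \<in> box i (a - 1) j (b - 1)" if "u \<in> Z" for u
    proof -
      have u: "u \<in> Y" "u \<noteq> Diag a b" "u \<noteq> Cell a b" using that Y(3) by (auto simp: Z_def)
      then have ub: "row u \<le> a" "col u \<le> b" "u \<in> box i a j b"
        using subsetD[OF Y(5) u(1)] box_bounds[of u i a j b] by simp_all
      have ne: "\<not> (row u = a \<and> col u = b)" using u by (cases u) auto
      have cmp: "node_val A u < node_val A (Diag a b) \<longleftrightarrow>
          node_val B (flip u) < node_val B (flip (Diag a b))"
        "node_val A (Diag a b) < node_val A u \<longleftrightarrow>
          node_val B (flip (Diag a b)) < node_val B (flip u)"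
        by (rule chainD[OF Y(4) u(1) 4(3)], rule chainD[OF Y(4) 4(3) u(1)])
      have fv: "flip v \<in> box 1 (length B) 1 (length A)" if "v \<in> Y" for v
        using valid[OF that] by simp
      \<comment> \<open>A node in row \<open>a\<close> would lie in an earlier column, so it would
        have a smaller value than \<open>Diag a b\<close> but a larger position. The argument for
        column \<open>b\<close> is symmetric.\<close>
      have "row u \<noteq> a"
      proof
        assume r: "row u = a"
        then have "col u < b" using ne ub by simp
        then have "node_val A u < node_val A (Diag a b)"
          using node_val_less[OF valid[OF u(1)] valid[OF 4(3)]] by simp
        moreover have "node_val B (flip (Diag a b)) < node_val B (flip u)"
          using node_val_above_Diag[OF fv[OF u(1)], of b B] r \<open>col u < b\<close> by simp
        ultimately show False using cmp by simp
      qed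
      moreover have "col u \<noteq> b"
      proof
        assume r: "col u = b"
        then have "row u < a" using ne ub by simp
        then have "node_val B (flip u) < node_val B (flip (Diag a b))"
          using node_val_less[OF fv[OF u(1)] fv[OF 4(3)]] by simp
        moreover have "node_val A (Diag a b) < node_val A u"
          using node_val_above_Diag[OF valid[OF u(1)], of a A] r \<open>row u < a\<close> by simp
        ultimately show False using cmp by simp
      qed
      ultimately show ?thesis
        using box_shrink[OF ub(3), of "a - 1" "b - 1"] ub(1,2) by simp
    qed
    moreover have "sum (node_weight c d) Y = int c + sum (node_weight c d) Z"
      unfolding Z_def using Y(1) 4(3) by (simp add: sum.remove)
    moreover have "chain A B Z" "finite Z"
      using Y chain_subset[of A B Y Z] by (auto simp: Z_def)
    ultimately show ?thesis
      by (intro snoc[of Z "a - 1" "b - 1"]) (use 4(1,2) in \<open>auto simp: dtw_step_def\<close>)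
  next
    case 5
    \<comment> \<open>\<open>u\<close> lies on the last column and \<open>v\<close> on the last row, so they are ordered oppositely by
      value and by position.\<close>
    have bb: "row u \<le> a" "col v \<le> b"
      using subsetD[OF Y(5) 5(2)] subsetD[OF Y(5) 5(4)] box_bounds[of _ i a j b] by simp_all
    have "row u \<noteq> a" using 5 Y(3) by (cases u) auto
    moreover have "col v \<noteq> b" using 5 Y(3) by (cases v) auto
    ultimately have "row u < row v" "col v < col u" using bb 5 by auto
    then have "node_val A v < node_val A u" "node_val B (flip u) < node_val B (flip v)"
      using node_val_less[OF valid[OF 5(4)] valid[OF 5(2)]] valid[OF 5(2)] valid[OF 5(4)]
        node_val_less[of "flip u" B "length A" "flip v" "length A"] by simp_all
    moreover have "node_val A v < node_val A u \<longleftrightarrow> node_val B (flip v) < node_val B (flip u)"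
      by (rule chainD[OF Y(4) 5(4,2)])
    ultimately show ?thesis by simp
  qed
qed

text \<open>The chain consists of the visited cells and one \<open>Diag\<close> for each diagonal
  step. Equality holds because a diagonal step saves one cell and its \<open>Diag\<close> restores
  the weight \<open>c\<close>.\<close>

lemma chain_of_alignment:
  assumes "is_alignment i a j b P" "1 \<le> i" "a \<le> length A" "1 \<le> j" "b \<le> length B"
  shows "i \<le> a \<and> j \<le> b \<and> (\<exists>X. finite X \<and> X \<subseteq> box i a j b \<and> chain A B X \<and>
    sum (node_weight c d) X + int (discrepancy d P) =
      int c * (int a - int i + int b - int j + 1))"
  using assms
proof (induction P arbitrary: a b rule: rev_induct)
  case Nil
  then show ?case by (simp add: is_alignment_def)
next
  case (snoc p P)
  have p: "p = (a, b)" using snoc.prems(1) by (simp add: is_alignment_def)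
  have below: "node_val A u < node_val A (Cell a b)" "node_val B (flip u) < node_val B (flip (Cell a b))"
    if "u \<in> box i a j b" "u \<noteq> Cell a b" for u
  proof -
    have "u \<in> box 1 a 1 b" using that snoc.prems by (blast intro: box_mono)
    moreover from this have "flip u \<in> box 1 b 1 a" by simp
    moreover have "flip u \<noteq> Cell b a" using that by (cases u) auto
    ultimately show "node_val A u < node_val A (Cell a b)"
      "node_val B (flip u) < node_val B (flip (Cell a b))"
      using node_val_below_Cell[of u a b A] node_val_below_Cell[of "flip u" b a B] that snoc.prems
      by simp_all
  qed
  have add: "finite (insert (Cell a b) Y) \<and> insert (Cell a b) Y \<subseteq> box i a j b \<and>
      chain A B (insert (Cell a b) Y) \<and>
      sum (node_weight c d) (insert (Cell a b) Y) = sum (node_weight c d) Y + int c - int (d a b)"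
    if "finite Y" "Y \<subseteq> box i a j b" "Cell a b \<notin> Y" "chain A B Y" "i \<le> a" "j \<le> b" for Y
  proof -
    have "chain A B (insert (Cell a b) Y)"
      using that below by (intro chain_insert_top) blast+
    then show ?thesis using that snoc.prems by auto
  qed
  show ?case
  proof (cases "P = []")
    case True
    then have "i = a" "j = b" using snoc.prems(1) p by (auto simp: is_alignment_def)
    then show ?thesis
      using add[of "{}"] True p
      by (auto simp: chain_def discrepancy_def intro!: exI[of _ "{Cell a b}"])
  next
    case False
    obtain a' b' where l: "last P = (a', b')" by fastforce
    have al: "is_alignment i a' j b' P" and step: "dtw_step (a', b') (a, b)"
      using snoc.prems(1) False l p by (auto simp: is_alignment_def successively_append_iff)
    have le: "a' \<le> a" "b' \<le> b" using step by (auto simp: dtw_step_def)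
    obtain X where X: "i \<le> a'" "j \<le> b'" "finite X" "X \<subseteq> box i a' j b'" "chain A B X"
      "sum (node_weight c d) X + int (discrepancy d P) =
      int c * (int a' - int i + int b' - int j + 1)"
      using snoc.IH[OF al] snoc.prems le by auto
    \<comment> \<open>\<open>Y\<close> is the chain just before the final cell: \<open>X\<close>
      itself after a straight step, and \<open>X\<close> with \<open>Diag a b\<close> added after a
      diagonal one.\<close>
    obtain Y where Y: "finite Y" "Y \<subseteq> box i a j b" "Cell a b \<notin> Y" "chain A B Y"
      "sum (node_weight c d) Y + int (discrepancy d P) = int c * (int a - int i + int b - int j)"
    proof (cases "a = a' + 1 \<and> b = b' + 1")
      case True
      let ?Y = "insert (Diag a b) X"
      have D: "Diag a b \<in> box 1 (length A) 1 (length B)" using snoc.prems X True by simp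
      have "node_val A u < node_val A (Diag a b) \<and> node_val B (flip u) < node_val B (flip (Diag a b))"
        if "u \<in> X" for u
      proof -
        have "row u < a" "col u < b" using X(4) that box_bounds[of u i a' j b'] True by auto
        moreover have "u \<in> box 1 (length A) 1 (length B)"
          using X(4) that True snoc.prems by (force intro: box_mono[of u i a' j b'])
        moreover from this D have "flip u \<in> box 1 (length B) 1 (length A)"
          "flip (Diag a b) \<in> box 1 (length B) 1 (length A)" by simp_all
        ultimately show ?thesis
          using node_val_less[of u A _ "Diag a b"] node_val_less[of "flip u" B _ "flip (Diag a b)"] D
          by auto
      qed
      then have "chain A B ?Y" using X by (intro chain_insert_top) auto
      moreover have "X \<subseteq> box i a j b"
        using X(4) le by (auto intro: box_mono)
      moreover have "Diag a b \<notin> X" "Cell a b \<notin> X" using X(4) True by auto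
      ultimately show ?thesis
        using X True by (intro that[of ?Y]) (auto simp: algebra_simps)
    next
      case False
      have "Cell a b \<notin> X" using X(4) step by (auto simp: dtw_step_def)
      moreover have "X \<subseteq> box i a j b"
        using X(4) le by (auto intro: box_mono)
      moreover have "int a' + int b' + 1 = int a + int b"
        using False step by (auto simp: dtw_step_def)
      then have "int a' - int i + int b' - int j + 1 = int a - int i + int b - int j" by linarith
      ultimately show ?thesis
        using X by (intro that[of X]) auto
    qed
    show ?thesis
      using add[OF Y(1-4)] Y(5) X le p
      by (auto simp: algebra_simps intro!: exI[of _ "insert (Cell a b) Y"])
  qed
qed


section \<open>Increasing subsequences of concatenated intervals\<close>

lemma finite_banded_lis_lengths:
  "finite {length T | T. subseq T S \<and> T \<noteq> [] \<and> successively (<) T \<and> set T \<subseteq> {lo..hi::int}}"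
  by (rule finite_subset[of _ "{..length S}"]) (auto dest: list_emb_length)

text \<open>The inserted default \<open>0\<close> is the length of the empty list, so this bound and
  the next lemma cover \<open>T = []\<close> as well.\<close>

lemma banded_lis_length_ge:
  assumes "subseq T S" "successively (<) T" "set T \<subseteq> {lo..hi}"
  shows "length T \<le> banded_lis_length lo hi S"
  unfolding banded_lis_length_def
  using assms finite_banded_lis_lengths[of S lo hi] by (cases "T = []") (auto intro!: Max_ge)

lemma banded_lis_length_attained:
  obtains T where "subseq T S" "successively (<) T" "set T \<subseteq> {lo..hi}"
    "length T = banded_lis_length lo hi S"
proof -
  let ?L = "{length T | T. subseq T S \<and> T \<noteq> [] \<and> successively (<) T \<and> set T \<subseteq> {lo..hi}}"
  have "banded_lis_length lo hi S \<in> insert 0 ?L"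
    unfolding banded_lis_length_def using finite_banded_lis_lengths by (intro Max_in) auto
  then consider "banded_lis_length lo hi S = 0" | "banded_lis_length lo hi S \<in> ?L"
    by (elim insertE)
  then show ?thesis
  proof cases
    case 1
    then show ?thesis by (intro that[of "[]"]) auto
  next
    case 2
    then show ?thesis using that by force
  qed
qed

lemma set_mono_subseq: "subseq xs ys \<Longrightarrow> set xs \<subseteq> set ys"
  by (blast elim: list_emb_set)

lemma sorted_wrt_subseq:
  assumes "subseq xs ys" "sorted_wrt P ys"
  shows "sorted_wrt P xs"
  using assms by (induction rule: list_emb.induct) (auto dest: set_mono_subseq)

text \<open>Both orders are the order of occurrence in the list. This turns a list sorted by value
  and by position into a \<open>chain\<close>.\<close>

lemma sorted_wrt_less_agree:
  fixes f g :: "'a \<Rightarrow> 'b::linorder"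
  assumes "sorted_wrt (\<lambda>x y. f x < f y) xs" "sorted_wrt (\<lambda>x y. g x < g y) xs"
    and "x \<in> set xs" "y \<in> set xs"
  shows "f x < f y \<longleftrightarrow> g x < g y"
  using assms by (induction xs) (auto dest: order.asym)

text \<open>\<open>ps\<close> collects the indices whose interval contributes to \<open>T\<close>.
  The last conjunct records a contributed element for each of them; it drives the induction and
  later places every chosen element inside the band.\<close>

lemma increasing_subseq_of_intervals:
  fixes lo hi :: "'a::linorder \<Rightarrow> int"
  assumes "subseq T (concat (map (\<lambda>q. [lo q..hi q]) qs))" "sorted_wrt (<) T" "distinct qs"
    and "\<And>q q'. \<lbrakk>q \<in> set qs; q' \<in> set qs; q < q'\<rbrakk> \<Longrightarrow> hi q < lo q'"
  shows "\<exists>ps. subseq ps qs \<and> sorted_wrt (<) ps \<and>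
    length T \<le> (\<Sum>q\<leftarrow>ps. length [lo q..hi q]) \<and> (\<forall>q \<in> set ps. \<exists>t \<in> set T. lo q \<le> t \<and> t \<le> hi q)"
  using assms
proof (induction qs arbitrary: T)
  case Nil
  then show ?case by (auto intro!: exI[of _ "[]"])
next
  case (Cons q qs)
  obtain T1 T2 where T: "T = T1 @ T2" "subseq T1 [lo q..hi q]"
    "subseq T2 (concat (map (\<lambda>q. [lo q..hi q]) qs))"
    using Cons.prems(1) by (auto simp: subseq_append_iff elim: subseq_appendE)
  have inc: "sorted_wrt (<) T2" "\<And>x y. x \<in> set T1 \<Longrightarrow> y \<in> set T2 \<Longrightarrow> x < y"
    using Cons.prems(2) by (auto simp: T sorted_wrt_append)
  obtain ps where ps: "subseq ps qs" "sorted_wrt (<) ps"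
    "length T2 \<le> (\<Sum>q\<leftarrow>ps. length [lo q..hi q])"
    "\<forall>q \<in> set ps. \<exists>t \<in> set T2. lo q \<le> t \<and> t \<le> hi q"
    using Cons.IH[OF T(3) inc(1)] Cons.prems(3,4) by auto
  show ?case
  proof (cases "T1 = []")
    case True
    then show ?thesis using ps T by (auto intro!: exI[of _ ps])
  next
    case False
    then obtain t where t: "t \<in> set T1" by fastforce
    then have tq: "lo q \<le> t" "t \<le> hi q" using set_mono_subseq[OF T(2)] by auto
    \<comment> \<open>Otherwise the interval of \<open>q'\<close> would lie below that of
      \<open>q\<close>, although it contains an element of \<open>T2\<close>, which must exceed
      \<open>t\<close>.\<close>
    have "q < q'" if q': "q' \<in> set ps" for q'
    proof (rule ccontr)
      assume "\<not> q < q'"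
      moreover have "q' \<in> set qs" using set_mono_subseq[OF ps(1)] q' by auto
      moreover from this have "q \<noteq> q'" using Cons.prems(3) by auto
      ultimately have "hi q' < lo q" using Cons.prems(4)[of q' q] by auto
      moreover obtain t' where "t' \<in> set T2" "t' \<le> hi q'" using ps(4) q' by blast
      ultimately show False using inc(2)[OF t, of t'] tq by auto
    qed
    moreover have "length T1 \<le> length [lo q..hi q]" using T(2) by (rule list_emb_length)
    ultimately show ?thesis
      using ps T t tq by (intro exI[of _ "q # ps"]) auto
  qed
qed

lemma sorted_wrt_concat_intervals:
  fixes lo hi :: "'a::linorder \<Rightarrow> int"
  assumes "sorted_wrt (<) ps"
    and "\<And>q q'. \<lbrakk>q \<in> set ps; q' \<in> set ps; q < q'\<rbrakk> \<Longrightarrow> hi q < lo q'"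
  shows "sorted_wrt (<) (concat (map (\<lambda>q. [lo q..hi q]) ps))"
  using assms
proof (induction ps)
  case (Cons q ps)
  have "x < y" if "x \<le> hi q" "q' \<in> set ps" "lo q' \<le> y" for x y q'
    using Cons.prems(1) Cons.prems(2)[of q q'] that by auto
  moreover have "sorted_wrt (<) [lo q..hi q]" by simp
  ultimately show ?case using Cons by (auto simp: sorted_wrt_append)
qed simp

lemma subseq_concat_map:
  assumes "subseq ps qs"
  shows "subseq (concat (map f ps)) (concat (map f qs))"
  using assms by (induction rule: list_emb.induct) (auto intro: list_emb_append_mono)

text \<open>The bounds have the form that \<open>g_start_eq\<close> and \<open>g_end_eq\<close>
  produce: one past the length of the prefix, and the length of the prefix together with the
  segment.\<close>

lemma segment_append:
  "segment (U @ V @ W) (int (length U) + 1) (int (length U) + int (length V)) = V"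
proof -
  let ?I = "{k. int (length U) + 1 \<le> int k + 1 \<and> int k + 1 \<le> int (length U) + int (length V)}"
  have "nths U ?I = []" "nths W {k. k + length V + length U \<in> ?I} = []"
    by (auto simp: set_nths simp flip: set_empty)
  moreover have "nths V {k. k + length U \<in> ?I} = V"
    by (rule nths_all) auto
  ultimately show ?thesis
    unfolding segment_def by (simp add: nths_append ac_simps)
qed


section \<open>The weighted sequence\<close>

lemma max_dissim_ge:
  assumes "1 \<le> x" "x \<le> length A" "1 \<le> y" "y \<le> length B"
  shows "d x y \<le> max_dissim A B d"
  unfolding max_dissim_def using assms by (intro Max_ge) force+

lemma node_weight_nonneg:
  assumes "u \<in> box 1 (length A) 1 (length B)"
  shows "0 \<le> node_weight (max_dissim A B d) d u"
  using assms max_dissim_ge[of _ A _ B d] by (cases u) auto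

text \<open>The strict lower bounds of \<open>box\<close> at 1 are the conditions
  \<open>2 \<le> i\<close> and \<open>2 \<le> j\<close> of \<open>diag\<close>, and the position
  formulas are the value formulas with the two series exchanged.\<close>

lemma R_occ_iff:
  "R_occ A B d q p w \<longleftrightarrow> (\<exists>u \<in> box 1 (length A) 1 (length B).
     q = node_val A u \<and> p = node_val B (flip u) \<and> w = node_weight (max_dissim A B d) d u)"
    (is "_ \<longleftrightarrow> ?r")
proof
  assume "R_occ A B d q p w"
  then show ?r
  proof cases
    case (cell i j)
    then show ?thesis by (intro bexI[of _ "Cell i j"]) (auto simp: r_elem_def)
  next
    case (diag i j)
    then show ?thesis by (intro bexI[of _ "Diag i j"]) (auto simp: rt_elem_def)
  qed
next
  assume ?r
  then obtain u where u: "u \<in> box 1 (length A) 1 (length B)" "q = node_val A u"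
    "p = node_val B (flip u)" "w = node_weight (max_dissim A B d) d u" by blast
  show "R_occ A B d q p w"
  proof (cases u)
    case (Cell x y)
    then show ?thesis using u R_occ.cell[of x A y B d] by (simp add: r_elem_def)
  next
    case (Diag x y)
    then show ?thesis using u R_occ.diag[of x A y B d] by (simp add: rt_elem_def)
  qed
qed

lemma R_occ_node:
  "u \<in> box 1 (length A) 1 (length B) \<Longrightarrow>
    R_occ A B d (node_val A u) (node_val B (flip u)) (node_weight (max_dissim A B d) d u)"
  by (auto simp: R_occ_iff)

lemma R_elems_eq: "R_elems A B d = node_val A ` box 1 (length A) 1 (length B)"
  by (auto simp: R_elems_def R_occ_iff)

lemma R_weight_nonneg: "q \<in> R_elems A B d \<Longrightarrow> 0 \<le> R_weight A B d q"
  using node_weight_nonneg R_weight_eq[OF R_occ_node] by (fastforce simp: R_elems_eq)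

lemma inj_on_node_val: "inj_on (node_val A) (box 1 (length A) 1 n)"
proof (rule inj_onI)
  fix u v
  assume *: "u \<in> box 1 (length A) 1 n" "v \<in> box 1 (length A) 1 n" "node_val A u = node_val A v"
  then have "\<not> col u < col v" "\<not> col v < col u"
    using node_val_less[of u A n v n] node_val_less[of v A n u n] by auto
  then have "col u = col v" by simp
  then show "u = v"
    using * by (cases u; cases v) (auto simp: r_elem_def rt_elem_def)
qed

text \<open>The cell in row 1 of column \<open>j\<close> separates the \<open>Diag\<close> nodes of
  that column from its cells, which gives the strict lower bound of \<open>box\<close>; the cell in
  the last row of column \<open>j'\<close> tops its window. Flipped, the same lemma describes
  intervals of positions.\<close>

lemma node_val_band:
  assumes u: "u \<in> box 1 (length A) 1 n" and "1 \<le> j" "j \<le> n" "1 \<le> j'" "j' \<le> n"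
  shows "r_elem A 1 j \<le> node_val A u \<and> node_val A u \<le> r_elem A (length A) j' \<longleftrightarrow>
    u \<in> box 1 (length A) j j'"
proof -
  have A: "1 \<le> length A" using box_bounds[OF u] by simp
  have "r_elem A 1 j \<le> node_val A u \<longleftrightarrow> u \<in> box 1 (length A) j n"
  proof -
    consider "col u < j" | "col u = j" | "j < col u" by linarith
    then show ?thesis
    proof cases
      case 1
      then show ?thesis
        using node_val_less[OF u, of "Cell 1 j" n] A assms(2,3) box_bounds(3)[of u 1 "length A" j n]
        by fastforce
    next
      case 2
      then show ?thesis
        using u by (cases u) (auto simp: r_elem_def rt_elem_def)
    next
      case 3
      moreover have "u \<in> box 1 (length A) j n" using u 3 by (cases u) auto
      ultimately show ?thesis
        using node_val_less[OF _ u, of "Cell 1 j" n] A assms(2,3) by simp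
    qed
  qed
  moreover have "node_val A u \<le> r_elem A (length A) j' \<longleftrightarrow> col u \<le> j'"
  proof -
    consider "col u < j'" | "col u = j'" | "j' < col u" by linarith
    then show ?thesis
    proof cases
      case 1
      then show ?thesis
        using node_val_less[OF u, of "Cell (length A) j'" n] A assms(4,5) by simp
    next
      case 2
      then show ?thesis
        using node_val_bounds(2)[OF u] by (simp add: r_elem_def)
    next
      case 3
      then show ?thesis
        using node_val_less[OF _ u, of "Cell (length A) j'" n] A assms(4,5) by simp
    qed
  qed
  moreover have "u \<in> box 1 (length A) j n \<and> col u \<le> j' \<longleftrightarrow> u \<in> box 1 (length A) j j'"
    using u assms by (cases u) auto
  ultimately show ?thesis by blast
qed

definition R_at :: "'a list \<Rightarrow> 'b list \<Rightarrow> (nat \<Rightarrow> nat \<Rightarrow> nat) \<Rightarrow> int \<Rightarrow> int" where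
  "R_at A B d p = (THE q. \<exists>w. R_occ A B d q p w)"

definition R_len :: "'a list \<Rightarrow> 'b list \<Rightarrow> int" where
  "R_len A B = int (length A) * int (length B) + (int (length A) - 1) * (int (length B) - 1)"

lemma R_seq_eq: "R_seq A B d = map (R_at A B d) [1..R_len A B]"
  by (simp add: R_seq_def R_at_def[abs_def] R_len_def)

lemma R_at_eq: "R_occ A B d q p w \<Longrightarrow> R_at A B d p = q"
  unfolding R_at_def by (blast dest: R_occ_inj)

section \<open>Positions, blocks and prefix lengths of the sequence\<close>

context
  fixes A :: "'a list" and B :: "'b list" and d :: "nat \<Rightarrow> nat \<Rightarrow> nat"
  assumes nonempty: "A \<noteq> []" "B \<noteq> []"
begin

abbreviation block :: "int \<Rightarrow> int list" where
  "block q \<equiv> [h_start A B d q..h_end A B d q]"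

abbreviation blocks :: "int \<Rightarrow> int \<Rightarrow> int list" where
  "blocks p p' \<equiv> concat (map block (map (R_at A B d) [p..p']))"

lemma pos_range: "R_occ A B d q p w \<Longrightarrow> 1 \<le> p \<and> p \<le> R_len A B"
  using R_occ_pos[OF nonempty, of d p] by (auto simp: R_len_def)

lemma R_at_occ:
  assumes "1 \<le> p" "p \<le> R_len A B"
  shows "R_occ A B d (R_at A B d p) p (R_weight A B d (R_at A B d p))"
proof -
  obtain q w where "R_occ A B d q p w"
    using R_occ_pos[OF nonempty, of d p] assms by (auto simp: R_len_def)
  then show ?thesis using R_at_eq R_weight_eq by metis
qed

lemma R_at_in_R_elems: "1 \<le> p \<Longrightarrow> p \<le> R_len A B \<Longrightarrow> R_at A B d p \<in> R_elems A B d"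
  using R_at_occ by (auto simp: R_elems_def)

lemma R_pos_R_at: "1 \<le> p \<Longrightarrow> p \<le> R_len A B \<Longrightarrow> R_pos A B d (R_at A B d p) = p"
  by (rule R_pos_eq[OF R_at_occ])

text \<open>This converts the sums over elements in \<open>g_end\<close> into prefixes of the
  sequence, and also yields finiteness of \<open>R_elems\<close>.\<close>

lemma bij_betw_R_at:
  assumes "k \<le> R_len A B"
  shows "bij_betw (R_at A B d) {1..k} {q \<in> R_elems A B d. R_pos A B d q \<le> k}"
proof (rule bij_betw_byWitness[where f' = "R_pos A B d"])
  show "\<forall>q \<in> {q \<in> R_elems A B d. R_pos A B d q \<le> k}. R_at A B d (R_pos A B d q) = q"
    by (auto simp: R_elems_def R_pos_eq R_at_eq)
  show "R_pos A B d ` {q \<in> R_elems A B d. R_pos A B d q \<le> k} \<subseteq> {1..k}"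
    using pos_range by (auto simp: R_elems_def R_pos_eq)
qed (use assms R_at_in_R_elems R_pos_R_at in auto)

lemma finite_R_elems: "finite (R_elems A B d)"
proof -
  have "R_elems A B d = {q \<in> R_elems A B d. R_pos A B d q \<le> R_len A B}"
    using pos_range by (auto simp: R_elems_def R_pos_eq)
  then show ?thesis
    using bij_betw_finite[OF bij_betw_R_at[OF order.refl]] by simp
qed

text \<open>Nonnegativity of the weight matters here: an interval with negative span would have
  length 0. A weight of 0 gives an empty block.\<close>

lemma length_block: "q \<in> R_elems A B d \<Longrightarrow> int (length (block q)) = R_weight A B d q"
  using R_weight_nonneg[of q A B d] by (simp add: h_start_def)

lemma length_concat_blocks:
  assumes "distinct qs" "set qs \<subseteq> R_elems A B d"
  shows "int (length (concat (map block qs))) = sum (R_weight A B d) (set qs)"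
proof -
  have "length (concat (map block qs)) = (\<Sum>q \<in> set qs. length (block q))"
    using assms(1) by (simp add: length_concat sum_list_distinct_conv_sum_set comp_def)
  then have "int (length (concat (map block qs))) = (\<Sum>q \<in> set qs. int (length (block q)))"
    by (simp only: of_nat_sum)
  also have "\<dots> = sum (R_weight A B d) (set qs)"
    using assms(2) by (intro sum.cong refl length_block) blast
  finally show ?thesis .
qed

lemma distinct_R_at:
  assumes "1 \<le> p" "p' \<le> R_len A B"
  shows "distinct (map (R_at A B d) [p..p'])"
  using assms R_pos_R_at
  by (auto simp: distinct_map intro!: inj_on_inverseI[of _ "R_pos A B d"])

lemma length_blocks_prefix:
  assumes "k \<le> R_len A B"
  shows "int (length (blocks 1 k)) =
    sum (R_weight A B d) {q \<in> R_elems A B d. R_pos A B d q \<le> k}"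
proof -
  have "set (map (R_at A B d) [1..k]) = {q \<in> R_elems A B d. R_pos A B d q \<le> k}"
    using bij_betw_imp_surj_on[OF bij_betw_R_at[OF assms]] by simp
  then show ?thesis
    using length_concat_blocks[of "map (R_at A B d) [1..k]"] distinct_R_at[of 1 k] assms
    by simp
qed

text \<open>\<open>h_start A B d q' - 1\<close> is the total weight of the elements below
  \<open>q'\<close>. These include all elements up to \<open>q\<close>, and weights are
  nonnegative.\<close>

lemma h_end_less_h_start:
  assumes "q \<in> R_elems A B d" "q' \<in> R_elems A B d" "q < q'"
  shows "h_end A B d q < h_start A B d q'"
proof -
  have "{x \<in> R_elems A B d. x \<le> q'} = insert q' {x \<in> R_elems A B d. x < q'}"
    using assms(2) by auto
  then have "h_end A B d q' = R_weight A B d q' + sum (R_weight A B d) {x \<in> R_elems A B d. x < q'}"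
    unfolding h_end_def using finite_R_elems by simp
  moreover have "h_end A B d q \<le> sum (R_weight A B d) {x \<in> R_elems A B d. x < q'}"
    unfolding h_end_def using finite_R_elems R_weight_nonneg assms(3) by (intro sum_mono2) auto
  ultimately show ?thesis by (simp add: h_start_def)
qed

text \<open>With \<open>g_start_eq\<close>, this identifies the \<open>g\<close> values as indices
  into \<open>dtw_sequence\<close>: they delimit the block of \<open>q\<close>.\<close>

lemma g_end_eq:
  assumes "R_occ A B d q p w"
  shows "g_end A B d q = int (length (blocks 1 p))"
  using length_blocks_prefix[of p] pos_range[OF assms]
  by (simp add: g_end_def R_pos_eq[OF assms])

lemma g_start_eq:
  assumes "R_occ A B d q p w"
  shows "g_start A B d q = int (length (blocks 1 (p - 1))) + 1"
proof -
  have "[1..p] = [1..p - 1] @ [p]"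
    using pos_range[OF assms] by (intro upto_rec2) simp
  moreover have "int (length (block q)) = R_weight A B d q"
    using assms by (intro length_block) (auto simp: R_elems_def)
  ultimately show ?thesis
    using g_end_eq[OF assms] by (simp add: g_start_def R_at_eq[OF assms] del: length_upto)
qed

lemma segment_dtw_sequence:
  assumes "R_occ A B d q p w" "R_occ A B d q' p' w'" "p \<le> p'"
  shows "segment (dtw_sequence A B d) (g_start A B d q) (g_end A B d q') = blocks p p'"
proof -
  have pp: "1 \<le> p" "p' \<le> R_len A B"
    using pos_range assms by blast+
  have "[1..p'] = [1..p - 1] @ [p..p']"
    using pp assms(3) upto_split1[of 1 p p'] by simp
  moreover from this have "[1..R_len A B] = [1..p - 1] @ [p..p'] @ [p' + 1..R_len A B]"
    using pp assms(3) upto_split2[of 1 p' "R_len A B"] by simp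
  ultimately have seq: "dtw_sequence A B d =
      blocks 1 (p - 1) @ blocks p p' @ blocks (p' + 1) (R_len A B)"
    and "blocks 1 p' = blocks 1 (p - 1) @ blocks p p'"
    by (simp_all add: dtw_sequence_def R_seq_eq)
  from this(2) have g_end: "g_end A B d q' =
      int (length (blocks 1 (p - 1))) + int (length (blocks p p'))"
    using g_end_eq[OF assms(2)] by simp
  show ?thesis
    unfolding g_start_eq[OF assms(1)] g_end seq by (rule segment_append)
qed

text \<open>The factor of \<open>c\<close> counts the cells plus diagonal steps of any alignment.
  The facts \<open>ge\<close> and \<open>le\<close> below translate alignments into banded
  increasing subsequences and back.\<close>

lemma dtw_eq_LIS:
  assumes "1 \<le> i" "i \<le> i'" "i' \<le> length A" "1 \<le> j" "j \<le> j'" "j' \<le> length B"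
  shows "int (dtw d i i' j j') =
    int (max_dissim A B d) * (int i' - int i + int j' - int j + 1) -
    int (banded_lis_length (H_start A B d j) (H_end A B d j')
      (segment (dtw_sequence A B d) (G_start A B d i) (G_end A B d i')))"
proof -
  let ?c = "max_dissim A B d"
  let ?W = "int ?c * (int i' - int i + int j' - int j + 1)"
  let ?V = "box 1 (length A) 1 (length B)"
  let ?S = "segment (dtw_sequence A B d) (G_start A B d i) (G_end A B d i')"
  define lo hi where "lo = H_start A B d j" and "hi = H_end A B d j'"
  define p p' where "p = r_elem B 1 i" and "p' = r_elem B (length B) i'"
  define qs where "qs = map (R_at A B d) [p..p']"
  have occ: "R_occ A B d (node_val A u) (node_val B (flip u)) (node_weight ?c d u)" if "u \<in> ?V" for u
    using R_occ_node[OF that] .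
  have B1: "1 \<le> length B" and A1: "1 \<le> length A" using assms by auto
  have start: "R_occ A B d (r_elem A i 1) p (node_weight ?c d (Cell i 1))"
    and stop: "R_occ A B d (r_elem A i' (length B)) p' (node_weight ?c d (Cell i' (length B)))"
    using occ[of "Cell i 1"] occ[of "Cell i' (length B)"] assms B1 by (simp_all add: p_def p'_def)
  have "p \<le> p'"
    using node_val_band[of "Cell 1 i" B "length A" i i'] assms B1 by (auto simp: p_def p'_def)
  have pp: "1 \<le> p" "p' \<le> R_len A B" using pos_range[OF start] pos_range[OF stop] by auto
  have S: "?S = concat (map block qs)"
    using segment_dtw_sequence[OF start stop \<open>p \<le> p'\<close>] by (simp add: G_start_def G_end_def qs_def)
  have qs_R: "set qs \<subseteq> R_elems A B d"
    using pp R_at_in_R_elems by (auto simp: qs_def)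
  \<comment> \<open>The segment selects rows, being a band of positions; the band of values selects
    columns.\<close>
  have node_in_qs: "node_val A u \<in> set qs \<longleftrightarrow> u \<in> box i i' 1 (length B)" if "u \<in> ?V" for u
  proof -
    have "node_val A u \<in> set qs \<longleftrightarrow> p \<le> node_val B (flip u) \<and> node_val B (flip u) \<le> p'"
    proof
      assume "node_val A u \<in> set qs"
      then obtain r where "node_val A u = R_at A B d r" "p \<le> r" "r \<le> p'" by (auto simp: qs_def)
      moreover from this have "R_pos A B d (node_val A u) = r" using pp R_pos_R_at by simp
      ultimately show "p \<le> node_val B (flip u) \<and> node_val B (flip u) \<le> p'"
        using R_pos_eq[OF occ[OF that]] by simp
    next
      assume "p \<le> node_val B (flip u) \<and> node_val B (flip u) \<le> p'"
      then show "node_val A u \<in> set qs"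
        using R_at_eq[OF occ[OF that]] by (force simp: qs_def)
    qed
    also have "\<dots> \<longleftrightarrow> flip u \<in> box 1 (length B) i i'"
      unfolding p_def p'_def using that assms by (intro node_val_band) auto
    finally show ?thesis by simp
  qed
  have band: "r_elem A 1 j \<le> node_val A u \<and> node_val A u \<le> r_elem A (length A) j' \<longleftrightarrow>
      u \<in> box 1 (length A) j j'" if "u \<in> ?V" for u
    using that assms by (intro node_val_band) auto
  have box_Int: "u \<in> box i i' j j' \<longleftrightarrow> u \<in> box i i' 1 (length B) \<and> u \<in> box 1 (length A) j j'" for u
    using assms by (cases u) auto
  have box_V: "u \<in> ?V" if "u \<in> box i i' j j'" for u
    using that assms by (auto intro: box_mono)
  have ends: "r_elem A 1 j \<in> R_elems A B d" "r_elem A (length A) j' \<in> R_elems A B d"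
    using assms A1 occ[of "Cell 1 j"] occ[of "Cell (length A) j'"] by (auto simp: R_elems_def)
  have h_le: "h_end A B d q \<le> h_end A B d q'" "h_start A B d q \<le> h_start A B d q'"
    if "q \<in> R_elems A B d" "q' \<in> R_elems A B d" "q \<le> q'" for q q'
    using h_end_less_h_start[of q q'] that R_weight_nonneg[of q A B d] R_weight_nonneg[of q' A B d]
    by (cases "q = q'"; simp add: h_start_def)+
  have pos_sorted: "sorted_wrt (\<lambda>q q'. R_pos A B d q < R_pos A B d q') qs"
    unfolding qs_def sorted_wrt_map
    by (rule sorted_wrt_mono_rel[OF _ sorted_wrt_upto]) (use pp R_pos_R_at in auto)
  have sum_vals: "sum (R_weight A B d) (node_val A ` X) = sum (node_weight ?c d) X"
    if "X \<subseteq> ?V" for X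
  proof -
    have "sum (R_weight A B d) (node_val A ` X) = (\<Sum>u \<in> X. R_weight A B d (node_val A u))"
      using inj_on_subset[OF inj_on_node_val that] by (simp add: sum.reindex)
    also have "\<dots> = sum (node_weight ?c d) X"
      using that by (intro sum.cong refl R_weight_eq[OF occ]) blast
    finally show ?thesis .
  qed
  have ge: "?W - int (discrepancy d P) \<le> int (banded_lis_length lo hi ?S)"
    if P: "is_alignment i i' j j' P" for P
  proof -
    obtain X where X: "X \<subseteq> box i i' j j'" "chain A B X"
      "sum (node_weight ?c d) X + int (discrepancy d P) = ?W"
      using chain_of_alignment[OF P assms(1,3,4,6), where c = ?c and d = d] by auto
    have XV: "X \<subseteq> ?V" using X(1) box_V by auto
    \<comment> \<open>Filtering lists the chain by position; the chain property then makes the list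
      increasing in value.\<close>
    define ps where "ps = filter (\<lambda>q. q \<in> node_val A ` X) qs"
    have set_ps: "set ps = node_val A ` X"
      using X(1) XV node_in_qs box_Int by (auto simp: ps_def)
    have sub: "subseq ps qs" by (simp add: ps_def)
    have "sorted_wrt (\<lambda>q q'. R_pos A B d q < R_pos A B d q') ps"
      using sorted_wrt_subseq[OF sub pos_sorted] .
    then have sorted: "sorted_wrt (<) ps"
    proof (rule sorted_wrt_mono_rel[rotated])
      fix q q'
      assume "q \<in> set ps" "q' \<in> set ps" "R_pos A B d q < R_pos A B d q'"
      then obtain u v where "u \<in> X" "v \<in> X" "q = node_val A u" "q' = node_val A v"
        by (auto simp: set_ps)
      moreover from this XV have "R_pos A B d q = node_val B (flip u)"
        "R_pos A B d q' = node_val B (flip v)"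
        using R_pos_eq[OF occ] by auto
      ultimately show "q < q'"
        using \<open>R_pos A B d q < R_pos A B d q'\<close> X(2) by (simp add: chain_def)
    qed
    have psR: "set ps \<subseteq> R_elems A B d" using qs_R by (auto simp: ps_def)
    let ?T = "concat (map block ps)"
    have "sorted_wrt (<) ?T"
      using sorted psR h_end_less_h_start by (intro sorted_wrt_concat_intervals) auto
    then have "successively (<) ?T"
      by (rule successively_if_sorted_wrt)
    moreover have "subseq ?T ?S" unfolding S by (rule subseq_concat_map[OF sub])
    moreover have "set ?T \<subseteq> {lo..hi}"
    proof
      fix t
      assume "t \<in> set ?T"
      then obtain u where u: "u \<in> X" "h_start A B d (node_val A u) \<le> t" "t \<le> h_end A B d (node_val A u)"
        by (auto simp: set_ps)
      then have "r_elem A 1 j \<le> node_val A u" "node_val A u \<le> r_elem A (length A) j'"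
        using band[of u] X(1) XV box_Int[of u] by auto
      moreover have "node_val A u \<in> R_elems A B d" using psR set_ps u(1) by auto
      ultimately show "t \<in> {lo..hi}"
        using h_le ends u(2,3) unfolding lo_def hi_def H_start_def H_end_def
        by (meson atLeastAtMost_iff order.trans)
    qed
    ultimately have "length ?T \<le> banded_lis_length lo hi ?S"
      by (intro banded_lis_length_ge)
    moreover have "distinct ps"
      unfolding ps_def qs_def using distinct_R_at pp by (intro distinct_filter) auto
    then have "int (length ?T) = sum (node_weight ?c d) X"
      using length_concat_blocks psR set_ps sum_vals[OF XV] by simp
    ultimately show ?thesis using X(3) by linarith
  qed
  have le: "\<exists>P. is_alignment i i' j j' P \<and>
      int (banded_lis_length lo hi ?S) + int (discrepancy d P) \<le> ?W"
  proof -
    obtain T where T: "subseq T ?S" "successively (<) T" "set T \<subseteq> {lo..hi}"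
      "length T = banded_lis_length lo hi ?S" by (rule banded_lis_length_attained)
    have "sorted_wrt (<) T" using T(2) by (simp add: successively_conv_sorted_wrt)
    moreover have "distinct qs" unfolding qs_def using distinct_R_at pp by auto
    moreover have "h_end A B d q < h_start A B d q'" if "q \<in> set qs" "q' \<in> set qs" "q < q'" for q q'
      using that qs_R by (intro h_end_less_h_start) auto
    ultimately obtain ps where ps: "subseq ps qs" "sorted_wrt (<) ps"
      "length T \<le> (\<Sum>q\<leftarrow>ps. length (block q))"
      "\<forall>q \<in> set ps. \<exists>t \<in> set T. h_start A B d q \<le> t \<and> t \<le> h_end A B d q"
      using increasing_subseq_of_intervals[of T "h_start A B d" "h_end A B d" qs]
        T(1) unfolding S by blast
    have ps_qs: "set ps \<subseteq> set qs" using set_mono_subseq[OF ps(1)] .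
    \<comment> \<open>The block of \<open>q\<close> contains a banded element of \<open>T\<close>.
      If \<open>q\<close> were outside the bounds, its whole block would be outside the
      band.\<close>
    have ps_band: "r_elem A 1 j \<le> q \<and> q \<le> r_elem A (length A) j'" if q: "q \<in> set ps" for q
    proof -
      obtain t where t: "t \<in> set T" "h_start A B d q \<le> t" "t \<le> h_end A B d q"
        using ps(4) q by blast
      then have "h_start A B d (r_elem A 1 j) \<le> t" "t \<le> h_end A B d (r_elem A (length A) j')"
        using T(3) by (auto simp: lo_def hi_def H_start_def H_end_def)
      moreover have "q \<in> R_elems A B d" using q ps_qs qs_R by blast
      ultimately show ?thesis
        using h_end_less_h_start[of q "r_elem A 1 j"] h_end_less_h_start[of "r_elem A (length A) j'" q]
          ends t(2,3) by linarith
    qed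
    \<comment> \<open>The preimage is taken inside \<open>?V\<close>, where
      \<open>node_val A\<close> is injective.\<close>
    define X where "X = {u \<in> ?V. node_val A u \<in> set ps}"
    have XV: "X \<subseteq> ?V" by (auto simp: X_def)
    have img: "node_val A ` X = set ps"
      using ps_qs qs_R by (auto simp: X_def R_elems_eq)
    have "finite X"
      using finite_imageD[of "node_val A" X] img inj_on_subset[OF inj_on_node_val XV] by simp
    moreover have "X \<subseteq> box i i' j j'"
    proof
      fix u
      assume "u \<in> X"
      then have u: "u \<in> ?V" "node_val A u \<in> set ps" by (simp_all add: X_def)
      then have "u \<in> box i i' 1 (length B)" using ps_qs node_in_qs by blast
      then show "u \<in> box i i' j j'" using ps_band u band box_Int by blast
    qed
    moreover have "chain A B X"
      unfolding chain_def
    proof (intro ballI)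
      fix u v
      assume uv: "u \<in> X" "v \<in> X"
      then have "node_val A u \<in> set ps" "node_val A v \<in> set ps" by (auto simp: X_def)
      then have "node_val A u < node_val A v \<longleftrightarrow>
          R_pos A B d (node_val A u) < R_pos A B d (node_val A v)"
        using sorted_wrt_less_agree[of "\<lambda>q. q" ps "R_pos A B d"] ps(2)
          sorted_wrt_subseq[OF ps(1) pos_sorted] by auto
      then show "node_val A u < node_val A v \<longleftrightarrow> node_val B (flip u) < node_val B (flip v)"
        using R_pos_eq[OF occ] subsetD[OF XV uv(1)] subsetD[OF XV uv(2)] by simp
    qed
    ultimately obtain P where P: "is_alignment i i' j j' P"
      "sum (node_weight ?c d) X + int (discrepancy d P) \<le> ?W"
      using chain_extends_to_alignment[of X i i' j j' A B d ?c] assms max_dissim_ge[of _ A _ B d]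
      by auto
    have "distinct ps" using ps(2) by (simp add: strict_sorted_iff)
    then have "int (length (concat (map block ps))) = sum (node_weight ?c d) X"
      using length_concat_blocks[of ps] ps_qs qs_R sum_vals[OF XV] img by simp
    moreover have "length T \<le> length (concat (map block ps))"
      using ps(3) by (simp add: length_concat comp_def)
    ultimately show ?thesis using P T(4) by (intro exI[of _ P]) linarith
  qed
  \<comment> \<open>\<open>Q\<close> serves twice: it shows that the minimum in \<open>dtw\<close>
    is attained, and its discrepancy bounds that minimum from above.\<close>
  obtain Q where Q: "is_alignment i i' j j' Q"
    "int (banded_lis_length lo hi ?S) + int (discrepancy d Q) \<le> ?W" using le by blast
  then have "\<exists>P. is_alignment i i' j j' P \<and> dtw d i i' j j' = discrepancy d P"
    unfolding dtw_def by (intro LeastI) blast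
  then obtain P where P: "is_alignment i i' j j' P" "dtw d i i' j j' = discrepancy d P" by blast
  have "dtw d i i' j j' \<le> discrepancy d Q"
    unfolding dtw_def using Q(1) by (intro Least_le) blast
  then have "int (banded_lis_length lo hi ?S) + int (dtw d i i' j j') \<le> ?W"
    using Q(2) by linarith
  moreover have "?W \<le> int (banded_lis_length lo hi ?S) + int (dtw d i i' j j')"
    using ge[OF P(1)] unfolding P(2) by linarith
  ultimately show ?thesis
    unfolding lo_def hi_def by linarith
qed

end

lemma length_segment:
  assumes "1 \<le> i" "i \<le> i'" "i' \<le> length S"
  shows "int (length (segment S (int i) (int i'))) = int i' - int i + 1"
proof -
  have "length (segment S (int i) (int i')) = card {i - 1..<i'}"
    unfolding segment_def length_nths by (rule arg_cong[where f = card]) (use assms in auto)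
  then show ?thesis using assms by simp
qed

theorem theorem2:
  fixes A :: "'a list" and B :: "'b list" and d :: "nat \<Rightarrow> nat \<Rightarrow> nat"
    and i i' j j' :: nat
  assumes "A \<noteq> []" and "B \<noteq> []"
    and "1 \<le> i" and "i \<le> i'" and "i' \<le> length A"
    and "1 \<le> j" and "j \<le> j'" and "j' \<le> length B"
  shows "int (dtw d i i' j j') =
    int (max_dissim A B d) *
      (int (length (segment A (int i) (int i'))) + int (length (segment B (int j) (int j'))) - 1) -
    int (banded_lis_length (H_start A B d j) (H_end A B d j')
      (segment (dtw_sequence A B d) (G_start A B d i) (G_end A B d i')))"
proof -
  have "int (length (segment A (int i) (int i'))) = int i' - int i + 1"
    "int (length (segment B (int j) (int j'))) = int j' - int j + 1"
    using assms by (simp_all add: length_segment)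
  then have len: "int (length (segment A (int i) (int i'))) +
      int (length (segment B (int j) (int j'))) - 1 = int i' - int i + int j' - int j + 1"
    by simp
  show ?thesis
    unfolding len by (rule dtw_eq_LIS[OF assms])
qed

end
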